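(* Let $r\ge 2$ be an integer and let $q_r$ denote the largest prime power not exceeding $2r-1$. Then \[ Q(r)\ge q_r . \] Moreover, for every integer $m\ge 1$, put \[ d_m=\left\lceil\frac{2^{m+1}-1}{m+1}\right\rceil . \] If $r\ge d_m$, then $Q(r)\ge 2^m$. Consequently, as $m\to\infty$, \[ Q(d_m)\ge\left(\frac12-o(1)\right)d_m\log_2 d_m, \] whereas, for arbitrary $r\to\infty$, \[ Q(r)\ge\left(\frac14-o(1)\right)r\log_2 r . \]
   Context: A vector is nowhere zero if none of its coordinates is zero. For an integer $r\ge 2$, $Q(r)$ is the infimum of the real numbers $Q$ such that, for every prime power $q>Q$, every $n\ge 1$, and every family $A_1,\ldots,A_r\in\operatorname{GL}_n(\mathbb{F}_q)$, there is an $x\in\mathbb{F}_q^n$ for which every $A_ix$ ($1\le i\le r$) is nowhere zero. (It is a known theorem of Nagy, Pach and Tomon that $Q(r)$ is finite.) Prime powers include primes. *)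

theory Defs
  imports
    "HOL-Algebra.Ring"
    "HOL-Number_Theory.Prime_Powers"
    "HOL-Library.Extended_Real"
    "HOL-Library.Landau_Symbols"
begin

definition vecs :: "('a, 'b) ring_scheme \<Rightarrow> nat \<Rightarrow> (nat \<Rightarrow> 'a) set" where
  "vecs F n = {..<n} \<rightarrow>\<^sub>E carrier F"

definition mat_vec ::
  "('a, 'b) ring_scheme \<Rightarrow> nat \<Rightarrow> (nat \<Rightarrow> nat \<Rightarrow> 'a) \<Rightarrow> (nat \<Rightarrow> 'a) \<Rightarrow> (nat \<Rightarrow> 'a)" where
  "mat_vec F n A x = (\<lambda>i\<in>{..<n}. \<Oplus>\<^bsub>F\<^esub>j\<in>{..<n}. A i j \<otimes>\<^bsub>F\<^esub> x j)"

(* A matrix is the extensional family of its rows, so that matrices which agree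
   on all indices below n are equal. *)
definition mat_monoid :: "('a, 'b) ring_scheme \<Rightarrow> nat \<Rightarrow> (nat \<Rightarrow> nat \<Rightarrow> 'a) monoid" where
  "mat_monoid F n =
    \<lparr>carrier = {..<n} \<rightarrow>\<^sub>E vecs F n,
     monoid.mult = (\<lambda>A B. \<lambda>i\<in>{..<n}. \<lambda>j\<in>{..<n}. \<Oplus>\<^bsub>F\<^esub>k\<in>{..<n}. A i k \<otimes>\<^bsub>F\<^esub> B k j),
     one = (\<lambda>i\<in>{..<n}. \<lambda>j\<in>{..<n}. if i = j then \<one>\<^bsub>F\<^esub> else \<zero>\<^bsub>F\<^esub>)\<rparr>"

definition GL :: "nat \<Rightarrow> ('a, 'b) ring_scheme \<Rightarrow> (nat \<Rightarrow> nat \<Rightarrow> 'a) set" where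
  "GL n F = Units (mat_monoid F n)"

definition nowhere_zero :: "('a, 'b) ring_scheme \<Rightarrow> nat \<Rightarrow> (nat \<Rightarrow> 'a) \<Rightarrow> bool" where
  "nowhere_zero F n y \<longleftrightarrow> (\<forall>i<n. y i \<noteq> \<zero>\<^bsub>F\<^esub>)"

(* F ranges over all fields of order q whose elements are natural numbers.
   Every finite field is isomorphic to such a field, and all fields of order q
   are isomorphic, so this is the condition on "the" field with q elements. *)
definition admissible :: "nat \<Rightarrow> real set" where
  "admissible r = {Q. \<forall>q. primepow q \<and> real q > Q \<longrightarrow>
     (\<forall>F :: nat ring. field F \<and> card (carrier F) = q \<longrightarrow>
       (\<forall>n\<ge>1. \<forall>A. (\<forall>i\<in>{1..r}. A i \<in> GL n F) \<longrightarrow>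
         (\<exists>x\<in>vecs F n. \<forall>i\<in>{1..r}. nowhere_zero F n (mat_vec F n (A i) x))))}"

(* The infimum is taken in the extended reals, so that the infimum of the empty
   set is infinity and lower bounds on Qinf r carry their usual meaning without
   first proving that admissible r is nonempty; see Qinf_eq_real_Inf. *)
definition Qinf :: "nat \<Rightarrow> ereal" where
  "Qinf r = Inf (ereal ` admissible r)"

lemma Qinf_eq_real_Inf:
  assumes "admissible r \<noteq> {}" "bdd_below (admissible r)"
  shows "Qinf r = ereal (Inf (admissible r))"
proof (rule antisym)
  show "ereal (Inf (admissible r)) \<le> Qinf r"
    unfolding Qinf_def using assms by (auto intro!: INF_greatest cInf_lower)
  have "Qinf r \<le> ereal x" if "x \<in> admissible r" for x
    unfolding Qinf_def using that by (auto intro: INF_lower)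
  then show "Qinf r \<le> ereal (Inf (admissible r))"
    using assms by (cases "Qinf r") (auto intro: cInf_greatest)
qed

definition max_primepow :: "nat \<Rightarrow> nat" where
  "max_primepow r = Max {q. primepow q \<and> q \<le> 2 * r - 1}"

definition dseq :: "nat \<Rightarrow> nat" where
  "dseq m = nat \<lceil>(2 ^ (m + 1) - 1) / (real m + 1)\<rceil>"

end

theory Submission
  imports Defs
    "HOL-Algebra.Algebraic_Closure"
    "HOL-Number_Theory.Residues"
    "HOL-Real_Asymp.Real_Asymp"
begin

text \<open>
  Everything follows from one construction. Let \<open>s\<close> be a prime power and let \<open>K\<close>, \<open>F\<close>, \<open>E\<close> be the
  subfields of orders \<open>s\<close>, \<open>s^m\<close>, \<open>s^n\<close>, \<open>n = m + 1\<close>, of an algebraically closed field. Let \<open>g\<close> generate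
  the cyclic group of nonzero elements of \<open>E\<close>. Then \<open>1, g, \<dots>, g^(n - 1)\<close> is a \<open>K\<close>-basis of \<open>E\<close>, and so is
  every window of \<open>n\<close> consecutive powers of \<open>g\<close>; hence the coordinate vectors of such a window are the
  rows of an invertible matrix over \<open>K\<close>. Up to factors in \<open>K\<close> there are only \<open>N = (s^n - 1) / (s - 1)\<close>
  powers of \<open>g\<close>, so \<open>r\<close> windows with \<open>r n \<ge> N\<close> contain every nonzero vector of \<open>K^n\<close> up to scaling.
  As \<open>|K^n| > |F|\<close>, the entries of any \<open>y \<in> F^n\<close> are linearly dependent over \<open>K\<close>, so some row
  annihilates \<open>y\<close>. Thus \<open>Q(r) \<ge> s^m\<close> as soon as \<open>r (m + 1) (s - 1) \<ge> s^(m + 1) - 1\<close>.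
  The first claim is the case \<open>m = 1\<close>, the second one the case \<open>s = 2\<close>.
\<close>

section \<open>The Frobenius map and finite fields\<close>

lemma (in cring) binomial_finsum:
  assumes x: "x \<in> carrier R" and y: "y \<in> carrier R"
  shows "(x \<oplus> y) [^] (n::nat) =
    (\<Oplus>k\<in>{..n}. [(n choose k)] \<cdot> (x [^] k \<otimes> y [^] (n - k)))"
proof (induction n)
  case 0
  show ?case by (simp add: add.nat_pow_eone)
next
  case (Suc n)
  define f where "f = (\<lambda>k. x [^] k \<otimes> y [^] (n - k))"
  have f: "f k \<in> carrier R" for k
    using x y by (simp add: f_def)
  have fx: "f k \<otimes> x = x [^] Suc k \<otimes> y [^] (n - k)" for k
    using x y by (simp add: f_def m_ac)
  have fy: "f k \<otimes> y = x [^] k \<otimes> y [^] (Suc n - k)" if "k \<le> n" for k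
    using x y that by (simp add: f_def m_ac Suc_diff_le)
  define g where "g = (\<lambda>k. x [^] k \<otimes> y [^] (Suc n - k))"
  have g: "g k \<in> carrier R" for k
    using x y by (simp add: g_def)
  have fx': "f k \<otimes> x = g (Suc k)" for k
    using fx by (simp add: g_def)
  have X: "(\<Oplus>k\<in>{..n}. [(n choose k)] \<cdot> f k) \<otimes> x = (\<Oplus>k\<in>{..n}. [(n choose k)] \<cdot> g (Suc k))"
    using f x g by (subst finsum_ldistr) (auto simp: add_pow_ldistr fx' intro!: finsum_cong')
  have fy': "f k \<otimes> y = g k" if "k \<le> n" for k
    using fy that by (simp add: g_def)
  have Y: "(\<Oplus>k\<in>{..n}. [(n choose k)] \<cdot> f k) \<otimes> y = (\<Oplus>k\<in>{..n}. [(n choose k)] \<cdot> g k)"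
    using f y g by (subst finsum_ldistr)
      (auto simp: add_pow_ldistr fy' intro!: finsum_cong')
  \<comment> \<open>The added term \<open>k = n + 1\<close> is zero. Splitting off
    \<open>g 0\<close> then aligns this sum with the one for \<open>x\<close>, and Pascal's rule
    joins the coefficients.\<close>
  have Y': "(\<Oplus>k\<in>{..n}. [(n choose k)] \<cdot> g k) = (\<Oplus>k\<in>{..Suc n}. [(n choose k)] \<cdot> g k)"
    using g by (simp add: binomial_eq_0)
  also have "\<dots> = (\<Oplus>k\<in>{..n}. [(n choose Suc k)] \<cdot> g (Suc k)) \<oplus> g 0"
    using g by (subst finsum_Suc2) (auto simp: add.nat_pow_eone)
  finally have Y'': "(\<Oplus>k\<in>{..n}. [(n choose k)] \<cdot> f k) \<otimes> y = \<dots>"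
    using Y by simp
  have "(x \<oplus> y) [^] Suc n = (\<Oplus>k\<in>{..n}. [(n choose k)] \<cdot> f k) \<otimes> x \<oplus> (\<Oplus>k\<in>{..n}. [(n choose k)] \<cdot> f k) \<otimes> y"
    using Suc f x y by (simp add: f_def r_distr)
  also have "\<dots> = (\<Oplus>k\<in>{..n}. [(n choose k)] \<cdot> g (Suc k) \<oplus> [(n choose Suc k)] \<cdot> g (Suc k)) \<oplus> g 0"
    unfolding X Y'' using g by (simp add: finsum_addf a_assoc)
  also have "\<dots> = (\<Oplus>k\<in>{..n}. [(Suc n choose Suc k)] \<cdot> g (Suc k)) \<oplus> g 0"
    using g by (simp add: add.nat_pow_mult)
  also have "\<dots> = (\<Oplus>k\<in>{..Suc n}. [(Suc n choose k)] \<cdot> g k)"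
    using g by (subst finsum_Suc2) (auto simp: add.nat_pow_eone)
  finally show ?case by (simp add: g_def)
qed

text \<open>A prime \<open>p\<close> divides every binomial coefficient strictly inside row
  \<open>p\<close>, so only the two outer terms survive; iteration gives \<open>p ^ k\<close>. Both
  the field and its polynomial ring need this.\<close>

lemma (in cring) freshmans_dream:
  fixes p :: nat
  assumes "Factorial_Ring.prime p" and char: "[p] \<cdot> \<one> = \<zero>"
    and x: "x \<in> carrier R" and y: "y \<in> carrier R"
  shows "(x \<oplus> y) [^] (p ^ k) = x [^] (p ^ k) \<oplus> y [^] (p ^ k)"
proof -
  have pz: "[p] \<cdot> z = \<zero>" if "z \<in> carrier R" for z
    using add_pow_ldistr[of \<one> z p] that char by simp
  have p0: "p > 0" using \<open>Factorial_Ring.prime p\<close> prime_gt_0_nat by blast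
  have step: "(a \<oplus> b) [^] p = a [^] p \<oplus> b [^] p" if a: "a \<in> carrier R" and b: "b \<in> carrier R" for a b
  proof -
    define f where "f = (\<lambda>k. [(p choose k)] \<cdot> (a [^] k \<otimes> b [^] (p - k)))"
    have f: "f k \<in> carrier R" for k using a b by (simp add: f_def)
    have mid: "f k = \<zero>" if "0 < k" "k < p" for k
    proof -
      have "p dvd (p choose k)"
        using that \<open>Factorial_Ring.prime p\<close> by (intro dvd_choose_prime) auto
      then obtain c where "p choose k = p * c" by blast
      then show ?thesis
        using a b by (simp add: f_def flip: add.nat_pow_pow) (simp add: pz)
    qed
    have "(a \<oplus> b) [^] p = (\<Oplus>k\<in>{..p}. f k)"
      using binomial_finsum[OF a b] by (simp add: f_def)
    also have "\<dots> = (\<Oplus>k\<in>{0,p}. f k)"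
      by (rule add.finprod_mono_neutral_cong_right) (use f mid in \<open>auto intro!: mid\<close>)
    also have "\<dots> = f 0 \<oplus> f p"
      using f p0 by simp
    also have "\<dots> = a [^] p \<oplus> b [^] p"
      using a b by (simp add: f_def a_comm add.nat_pow_eone)
    finally show ?thesis .
  qed
  show ?thesis
  proof (induction k)
    case 0 then show ?case using x y by (simp add: nat_pow_eone)
  next
    case (Suc k)
    have "(x \<oplus> y) [^] (p ^ Suc k) = ((x \<oplus> y) [^] (p ^ k)) [^] p"
      using x y by (simp add: nat_pow_pow mult.commute)
    also have "\<dots> = (x [^] (p ^ k)) [^] p \<oplus> (y [^] (p ^ k)) [^] p"
      using x y by (simp add: Suc step)
    finally show ?case
      using x y by (simp add: nat_pow_pow mult.commute)
  qed
qed

lemma (in cring) freshmans_dream_minus: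
  fixes p :: nat
  assumes "Factorial_Ring.prime p" and char: "[p] \<cdot> \<one> = \<zero>"
    and x: "x \<in> carrier R" and y: "y \<in> carrier R"
  shows "(x \<ominus> y) [^] (p ^ k) = x [^] (p ^ k) \<ominus> y [^] (p ^ k)"
proof -
  have "x [^] (p ^ k) = ((x \<ominus> y) \<oplus> y) [^] (p ^ k)"
    using x y by algebra
  also have "\<dots> = (x \<ominus> y) [^] (p ^ k) \<oplus> y [^] (p ^ k)"
    using assms by (intro freshmans_dream) auto
  finally show ?thesis using x y by (simp add: a_minus_def a_assoc r_neg)
qed

section \<open>Finite subfields as fixed points of Frobenius powers\<close>

lemma (in field) subfield_frobenius_fixed:
  fixes p :: nat
  assumes p: "Factorial_Ring.prime p" and char: "[p] \<cdot> \<one> = \<zero>"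
  shows "subfield {x \<in> carrier R. x [^] (p ^ k) = x} R"
proof (rule subfieldI')
  let ?K = "{x \<in> carrier R. x [^] (p ^ k) = x}"
  have p0: "p ^ k > 0" using p prime_gt_0_nat by simp
  show "subring ?K R"
  proof (rule subringI)
    fix h assume "h \<in> ?K"
    then have h: "h \<in> carrier R" "h [^] (p ^ k) = h" by auto
    \<comment> \<open>Writing the negative as a difference avoids a case split on the parity of
      \<open>p\<close>.\<close>
    have "(\<zero> \<ominus> h) [^] (p ^ k) = \<zero> [^] (p ^ k) \<ominus> h [^] (p ^ k)"
      using h by (intro freshmans_dream_minus[OF p char]) auto
    then show "\<ominus> h \<in> ?K"
      using h p0 by (simp add: a_minus_def nat_pow_zero)
  qed (auto simp: nat_pow_distrib freshmans_dream[OF p char])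
next
  fix x assume "x \<in> {x \<in> carrier R. x [^] (p ^ k) = x} - {\<zero>}"
  then have x: "x \<in> carrier R" "x \<noteq> \<zero>" "x [^] (p ^ k) = x" by auto
  then have u: "x \<in> Units R" by (simp add: field_Units)
  have "x \<otimes> inv x [^] (p ^ k) = (x \<otimes> inv x) [^] (p ^ k)"
    using x u by (subst nat_pow_distrib) auto
  then have "inv x [^] (p ^ k) = inv x"
    using x u by (intro comm_inv_char[symmetric]) auto
  then show "inv x \<in> {x \<in> carrier R. x [^] (p ^ k) = x}"
    using x u by simp
qed

lemma (in ring_hom_ring) hom_add_pow:
  assumes "x \<in> carrier R"
  shows "h ([(n::nat)] \<cdot> x) = [n] \<cdot>\<^bsub>S\<^esub> h x"
  using assms by (induction n) (simp_all add: R.add.nat_pow_Suc S.add.nat_pow_Suc)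

lemma size_eq_card_set_mset:
  assumes "\<And>a. count m a \<le> 1"
  shows "size m = card (set_mset m)"
proof -
  have "count m a = 1" if "a \<in> set_mset m" for a
    using assms[of a] that by (simp add: le_antisym Suc_le_eq)
  then have "(\<Sum>a\<in>set_mset m. count m a) = (\<Sum>a\<in>set_mset m. 1)"
    by (intro sum.cong) auto
  then show ?thesis
    by (simp add: size_multiset_overloaded_eq)
qed

text \<open>The roots of \<open>P = X^q - X\<close> are simple: for a root \<open>a\<close> and \<open>D = X - a\<close> one has \<open>P = D^q - D\<close>,
  and \<open>D^(q - 1) - 1\<close> does not vanish at \<open>a\<close>.\<close>

lemma (in field) card_frobenius_fixed:
  fixes p :: nat
  assumes p: "Factorial_Ring.prime p" and char: "[p] \<cdot> \<one> = \<zero>" and "k \<ge> 1"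
    and splits: "splitted (X [^]\<^bsub>poly_ring R\<^esub> (p ^ k) \<ominus>\<^bsub>poly_ring R\<^esub> X)"
  shows "card {x \<in> carrier R. x [^] (p ^ k) = x} = p ^ k"
proof -
  define q where "q = p ^ k"
  have "p ^ 1 \<le> p ^ k"
    using p \<open>k \<ge> 1\<close> prime_ge_1_nat by (intro power_increasing) auto
  then have q2: "q \<ge> 2"
    using prime_ge_2_nat[OF p] by (simp add: q_def)
  interpret UP: domain "poly_ring R"
    using univ_poly_is_domain[OF carrier_is_subring] .
  let ?P = "X [^]\<^bsub>poly_ring R\<^esub> q \<ominus>\<^bsub>poly_ring R\<^esub> X"
  have X: "X \<in> carrier (poly_ring R)"
    using var_closed(1)[OF carrier_is_subring] .
  have P: "?P \<in> carrier (poly_ring R)"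
    using X by simp
  have const: "ring_hom_ring R (poly_ring R) poly_of_const"
    using canonical_embedding_ring_hom[OF carrier_is_subring] by simp
  interpret C: ring_hom_ring R "poly_ring R" poly_of_const
    by (rule const)
  have charUP: "[p] \<cdot>\<^bsub>poly_ring R\<^esub> \<one>\<^bsub>poly_ring R\<^esub> = \<zero>\<^bsub>poly_ring R\<^esub>"
    using C.hom_add_pow[of \<one> p] char by simp
  have degP: "degree ?P = q"
  proof -
    have 1: "degree (X [^]\<^bsub>poly_ring R\<^esub> q) = q"
      using polynomial_pow_degree[OF X] by (simp add: var_def)
    have 2: "degree (\<ominus>\<^bsub>poly_ring R\<^esub> X) = 1"
      using univ_poly_a_inv_degree[OF carrier_is_subring X] by (simp add: var_def)
    have "degree (poly_add (X [^]\<^bsub>poly_ring R\<^esub> q) (\<ominus>\<^bsub>poly_ring R\<^esub> X)) = max q 1"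
      using X 1 2 q2 poly_add_degree_eq[OF carrier_is_subring,
          of "X [^]\<^bsub>poly_ring R\<^esub> q" "\<ominus>\<^bsub>poly_ring R\<^esub> X"]
      by (simp add: univ_poly_carrier)
    then show ?thesis
      using q2 by (simp add: a_minus_def univ_poly_add)
  qed
  then have Pne: "?P \<noteq> []"
    using q2 by auto
  have root_iff: "is_root ?P a \<longleftrightarrow> a \<in> carrier R \<and> a [^] q = a" for a
  proof (cases "a \<in> carrier R")
    case True
    interpret E: ring_hom_ring "poly_ring R" R "\<lambda>p. eval p a"
      using eval_ring_hom[OF carrier_is_subring True] .
    have "eval ?P a = a [^] q \<ominus> a"
      using X True by (simp add: a_minus_def E.hom_nat_pow eval_var)
    then show ?thesis
      using True Pne r_right_minus_eq[of "a [^] q" a] by (simp add: is_root_def)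
  qed (simp add: is_root_def)
  have mult: "alg_mult ?P a \<le> 1" for a
  proof (rule ccontr)
    assume "\<not> alg_mult ?P a \<le> 1"
    then have ge: "alg_mult ?P a \<ge> 2" by simp
    then have "is_root ?P a"
      using alg_mult_gt_zero_iff_is_root[OF P, of a] by linarith
    then have a: "a \<in> carrier R" "a [^] q = a"
      using root_iff by auto
    interpret E: ring_hom_ring "poly_ring R" R "\<lambda>p. eval p a"
      using eval_ring_hom[OF carrier_is_subring a(1)] .
    define D where "D = [\<one>, \<ominus> a]"
    define c where "c = poly_of_const a"
    have D: "D \<in> carrier (poly_ring R)" and c: "c \<in> carrier (poly_ring R)"
      using a C.hom_closed[OF a(1)]
      unfolding D_def c_def by (auto simp: polynomial_def simp flip: univ_poly_carrier)
    have XDc: "X = D \<oplus>\<^bsub>poly_ring R\<^esub> c"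
      using a by (auto simp: D_def c_def poly_of_const_def univ_poly_add var_def l_neg)
    have cq: "c [^]\<^bsub>poly_ring R\<^esub> q = c"
      using C.hom_nat_pow[OF a(1), of q] a(2) by (simp add: c_def)
    have evD: "eval D a = \<zero>" using a by (simp add: D_def r_neg)
    define Dq where "Dq = D [^]\<^bsub>poly_ring R\<^esub> (q - 1)"
    have Dq: "Dq \<in> carrier (poly_ring R)" using D by (simp add: Dq_def)
    have "Suc (q - 1) = q" using q2 by simp
    then have D_pow: "D [^]\<^bsub>poly_ring R\<^esub> q = D \<otimes>\<^bsub>poly_ring R\<^esub> Dq"
      using D UP.nat_pow_Suc2[of D "q - 1"] by (simp add: Dq_def)
    have "X [^]\<^bsub>poly_ring R\<^esub> q = D [^]\<^bsub>poly_ring R\<^esub> q \<oplus>\<^bsub>poly_ring R\<^esub> c [^]\<^bsub>poly_ring R\<^esub> q"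
      unfolding XDc q_def by (rule UP.freshmans_dream[OF p charUP D c])
    then have "?P = D \<otimes>\<^bsub>poly_ring R\<^esub> Dq \<oplus>\<^bsub>poly_ring R\<^esub> c \<ominus>\<^bsub>poly_ring R\<^esub> X"
      by (simp add: cq D_pow)
    also have "\<dots> = D \<otimes>\<^bsub>poly_ring R\<^esub> Dq \<oplus>\<^bsub>poly_ring R\<^esub> c \<ominus>\<^bsub>poly_ring R\<^esub> (D \<oplus>\<^bsub>poly_ring R\<^esub> c)"
      by (simp flip: XDc)
    also have "\<dots> = D \<otimes>\<^bsub>poly_ring R\<^esub> (Dq \<ominus>\<^bsub>poly_ring R\<^esub> \<one>\<^bsub>poly_ring R\<^esub>)"
      using D Dq c UP.r_one[OF D] by algebra
    finally have P1: "?P = D \<otimes>\<^bsub>poly_ring R\<^esub> (D [^]\<^bsub>poly_ring R\<^esub> (q - 1) \<ominus>\<^bsub>poly_ring R\<^esub> \<one>\<^bsub>poly_ring R\<^esub>)"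
      by (simp add: Dq_def)
    have "D [^]\<^bsub>poly_ring R\<^esub> (2::nat) pdivides ?P"
      using le_alg_mult_imp_pdivides[OF a(1) P ge] by (simp add: D_def)
    then obtain g where g: "g \<in> carrier (poly_ring R)"
      and "?P = D [^]\<^bsub>poly_ring R\<^esub> (2::nat) \<otimes>\<^bsub>poly_ring R\<^esub> g"
      unfolding pdivides_def by auto
    then have P2: "?P = D \<otimes>\<^bsub>poly_ring R\<^esub> (D \<otimes>\<^bsub>poly_ring R\<^esub> g)"
      using D by (simp add: numeral_2_eq_2 UP.m_assoc)
    \<comment> \<open>Cancelling \<open>D\<close> in \<open>P1\<close> and \<open>P2\<close> and
      evaluating at \<open>a\<close>, where \<open>D\<close> vanishes, leaves
      \<open>0 = - 1\<close>; the exponent \<open>q - 1\<close> is positive since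
      \<open>q \<ge> 2\<close>.\<close>
    have "D \<otimes>\<^bsub>poly_ring R\<^esub> g = D [^]\<^bsub>poly_ring R\<^esub> (q - 1) \<ominus>\<^bsub>poly_ring R\<^esub> \<one>\<^bsub>poly_ring R\<^esub>"
      using D g P1 P2 UP.m_lcancel[of D "D \<otimes>\<^bsub>poly_ring R\<^esub> g" "D [^]\<^bsub>poly_ring R\<^esub> (q - 1) \<ominus>\<^bsub>poly_ring R\<^esub> \<one>\<^bsub>poly_ring R\<^esub>"]
      by (simp add: D_def univ_poly_zero)
    then have "eval (D \<otimes>\<^bsub>poly_ring R\<^esub> g) a = eval (D [^]\<^bsub>poly_ring R\<^esub> (q - 1) \<ominus>\<^bsub>poly_ring R\<^esub> \<one>\<^bsub>poly_ring R\<^esub>) a"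
      by simp
    then have "eval D a \<otimes> eval g a = eval D a [^] (q - 1) \<ominus> \<one>"
      using D g a by (simp add: a_minus_def E.hom_nat_pow del: UP.nat_pow_Suc)
    then have "\<zero> = \<ominus> \<one>"
      using evD q2 a g D by (simp add: nat_pow_zero a_minus_def)
    then show False by (metis minus_minus minus_zero one_closed zero_not_one)
  qed
  \<comment> \<open>Splitting says that the multiset of roots has as many elements as the degree;
    simplicity identifies it with the set of roots.\<close>
  have "size (roots ?P) = card (set_mset (roots ?P))"
    by (rule size_eq_card_set_mset) (rule mult[unfolded alg_mult_eq_count_roots[OF P]])
  moreover have "set_mset (roots ?P) = {x \<in> carrier R. x [^] q = x}"
    using roots_mem_iff_is_root[OF P] root_iff by auto
  ultimately show ?thesis
    using splits degP by (simp add: splitted_def q_def)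
qed

text \<open>The algebraic closure of the integers modulo \<open>p\<close> serves for all
  \<open>k\<close> at once, because \<open>X ^ (p ^ k) - X\<close> splits in it. With all these
  finite fields inside one field, elements of different ones can later be multiplied.\<close>

lemma exists_field_frobenius_card:
  fixes p :: nat
  assumes p: "Factorial_Ring.prime p"
  obtains L :: "((int list \<times> nat) multiset \<Rightarrow> int) ring"
  where "field L" "[p] \<cdot>\<^bsub>L\<^esub> \<one>\<^bsub>L\<^esub> = \<zero>\<^bsub>L\<^esub>"
    "\<And>k. k \<ge> 1 \<Longrightarrow> card {x \<in> carrier L. x [^]\<^bsub>L\<^esub> (p ^ k) = x} = p ^ k"
proof -
  define R where "R = residue_ring (int p)"
  interpret residues_prime p R
    by unfold_locales (use p in \<open>auto simp: R_def\<close>)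
  have "[(n::nat)] \<cdot>\<^bsub>R\<^esub> \<one>\<^bsub>R\<^esub> = int n mod int p" for n
  proof (induction n)
    case 0 then show ?case by (simp add: res_zero_eq add_pow_def)
  next
    case (Suc n)
    then show ?case by (simp add: res_add_eq res_one_eq mod_simps add_pow_def add.commute)
  qed
  then have charR: "[p] \<cdot>\<^bsub>R\<^esub> \<one>\<^bsub>R\<^esub> = \<zero>\<^bsub>R\<^esub>"
    by (simp add: res_zero_eq)
  obtain L :: "((int list \<times> nat) multiset \<Rightarrow> int) ring"
    where L: "algebraic_closure L (indexed_const ` carrier R)" and h: "indexed_const \<in> ring_hom R L"
    by (rule exists_closure)
  define K :: "((int list \<times> nat) multiset \<Rightarrow> int) set"
    where "K = indexed_const ` carrier R"
  interpret L: algebraic_closure L K using L by (simp add: K_def)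
  interpret h: ring_hom_ring R L indexed_const
    by (rule ring_hom_ringI2[OF ring_axioms L.ring_axioms h])
  have charL: "[p] \<cdot>\<^bsub>L\<^esub> \<one>\<^bsub>L\<^esub> = \<zero>\<^bsub>L\<^esub>"
    using h.hom_add_pow[of "\<one>\<^bsub>R\<^esub>" p] charR by simp
  have K: "subring K L" using L.subfield_axioms subfieldE(1) by blast
  show thesis
  proof (rule that[OF _ charL])
    show "field L" by unfold_locales
    fix k :: nat assume k: "k \<ge> 1"
    let ?P = "\<lambda>U. X\<^bsub>L\<^esub> [^]\<^bsub>U\<^esub> (p ^ k) \<ominus>\<^bsub>U\<^esub> X\<^bsub>L\<^esub>"
    have X: "X\<^bsub>L\<^esub> \<in> carrier (K[X]\<^bsub>L\<^esub>)"
      using L.var_closed(1)[OF K] .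
    interpret UP: domain "K[X]\<^bsub>L\<^esub>"
      using L.univ_poly_is_domain[OF K] .
    \<comment> \<open>The closure provides splitting for polynomials over \<open>K\<close>, so this
      one is first formed there and then read over \<open>L\<close>.\<close>
    have "?P (K[X]\<^bsub>L\<^esub>) \<in> carrier (K[X]\<^bsub>L\<^esub>)"
      using X by simp
    then have "L.splitted (?P (K[X]\<^bsub>L\<^esub>))"
      by (rule L.roots_over_subfield)
    also have "?P (K[X]\<^bsub>L\<^esub>) = ?P (poly_ring L)"
      using L.univ_poly_a_minus_consistent[OF K X]
      by (simp add: nat_pow_def univ_poly_mult univ_poly_one)
    finally show "card {x \<in> carrier L. x [^]\<^bsub>L\<^esub> (p ^ k) = x} = p ^ k"
      using L.card_frobenius_fixed[OF p charL k] by simp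
  qed
qed

section \<open>Coordinates of the powers of a generator\<close>

lemma (in ring) finsum_in_subring:
  assumes "subring K R" "f \<in> A \<rightarrow> K"
  shows "finsum R f A \<in> K"
  using assms(2)
proof (induction A rule: infinite_finite_induct)
  case (insert x A)
  then have "f x \<in> carrier R" "f \<in> A \<rightarrow> carrier R"
    using subringE(1)[OF assms(1)] by auto
  then show ?case
    using insert subringE(7)[OF assms(1)] by auto
qed (use subringE(2)[OF assms(1)] in auto)

text \<open>Two families \<open>v\<close> matter: the powers of \<open>g\<close>, which expand
  elements of \<open>E\<close>, and the entries of a vector \<open>y\<close>, whose linear relations
  are sought.\<close>

definition (in ring) lin_comb :: "(nat \<Rightarrow> 'a) \<Rightarrow> nat \<Rightarrow> (nat \<Rightarrow> 'a) \<Rightarrow> 'a"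
  where "lin_comb v t b = (\<Oplus>i\<in>{..<t}. b i \<otimes> v i)"

context cring
begin

lemma lin_comb_closed [simp, intro]:
  "v \<in> {..<t} \<rightarrow> carrier R \<Longrightarrow> b \<in> {..<t} \<rightarrow> carrier R \<Longrightarrow> lin_comb v t b \<in> carrier R"
  unfolding lin_comb_def by (intro finsum_closed) auto

lemma lin_comb_cong:
  assumes "v \<in> {..<t} \<rightarrow> carrier R" "b' \<in> {..<t} \<rightarrow> carrier R" "\<And>i. i < t \<Longrightarrow> b i = b' i"
  shows "lin_comb v t b = lin_comb v t b'"
  unfolding lin_comb_def using assms by (intro finsum_cong') auto

lemma lin_comb_add:
  assumes "v \<in> {..<t} \<rightarrow> carrier R" "b \<in> {..<t} \<rightarrow> carrier R" "b' \<in> {..<t} \<rightarrow> carrier R"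
  shows "lin_comb v t (\<lambda>i. b i \<oplus> b' i) = lin_comb v t b \<oplus> lin_comb v t b'"
proof -
  have "lin_comb v t (\<lambda>i. b i \<oplus> b' i) = (\<Oplus>i\<in>{..<t}. b i \<otimes> v i \<oplus> b' i \<otimes> v i)"
    unfolding lin_comb_def using assms by (intro finsum_cong') (auto simp: l_distr Pi_iff)
  also have "\<dots> = lin_comb v t b \<oplus> lin_comb v t b'"
    unfolding lin_comb_def using assms by (intro finsum_addf) auto
  finally show ?thesis .
qed

lemma lin_comb_smult:
  assumes "v \<in> {..<t} \<rightarrow> carrier R" "b \<in> {..<t} \<rightarrow> carrier R" "a \<in> carrier R"
  shows "lin_comb v t (\<lambda>i. a \<otimes> b i) = a \<otimes> lin_comb v t b"
proof -
  have "lin_comb v t (\<lambda>i. a \<otimes> b i) = (\<Oplus>i\<in>{..<t}. a \<otimes> (b i \<otimes> v i))"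
    unfolding lin_comb_def using assms by (intro finsum_cong') (auto simp: m_assoc Pi_iff)
  also have "\<dots> = a \<otimes> lin_comb v t b"
    unfolding lin_comb_def using assms by (intro finsum_rdistr[symmetric]) auto
  finally show ?thesis .
qed

lemma lin_comb_smult_vec:
  assumes "v \<in> {..<t} \<rightarrow> carrier R" "b \<in> {..<t} \<rightarrow> carrier R" "a \<in> carrier R"
  shows "lin_comb (\<lambda>i. a \<otimes> v i) t b = a \<otimes> lin_comb v t b"
proof -
  have "lin_comb (\<lambda>i. a \<otimes> v i) t b = (\<Oplus>i\<in>{..<t}. a \<otimes> (b i \<otimes> v i))"
    unfolding lin_comb_def using assms by (intro finsum_cong') (auto simp: m_ac Pi_iff)
  also have "\<dots> = a \<otimes> lin_comb v t b"
    unfolding lin_comb_def using assms by (intro finsum_rdistr[symmetric]) auto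
  finally show ?thesis .
qed

lemma lin_comb_diff:
  assumes "v \<in> {..<t} \<rightarrow> carrier R" "b \<in> {..<t} \<rightarrow> carrier R" "b' \<in> {..<t} \<rightarrow> carrier R"
  shows "lin_comb v t (\<lambda>i. b i \<ominus> b' i) = lin_comb v t b \<ominus> lin_comb v t b'"
proof -
  have "lin_comb v t b = lin_comb v t (\<lambda>i. (b i \<ominus> b' i) \<oplus> b' i)"
    using assms by (intro lin_comb_cong) (auto simp: a_minus_def a_assoc l_neg Pi_iff)
  also have "\<dots> = lin_comb v t (\<lambda>i. b i \<ominus> b' i) \<oplus> lin_comb v t b'"
    using assms by (intro lin_comb_add) auto
  finally have "lin_comb v t b = lin_comb v t (\<lambda>i. b i \<ominus> b' i) \<oplus> lin_comb v t b'" .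
  moreover have "lin_comb v t b \<in> carrier R" "lin_comb v t b' \<in> carrier R"
    "lin_comb v t (\<lambda>i. b i \<ominus> b' i) \<in> carrier R"
    using assms by (auto intro!: lin_comb_closed)
  ultimately show ?thesis by (simp add: a_minus_def a_assoc r_neg)
qed

lemma lin_comb_unit:
  assumes "v \<in> {..<t} \<rightarrow> carrier R" "i < t"
  shows "lin_comb v t (\<lambda>j. if i = j then \<one> else \<zero>) = v i"
proof -
  have "lin_comb v t (\<lambda>j. if i = j then \<one> else \<zero>) = (\<Oplus>j\<in>{..<t}. if i = j then v j else \<zero>)"
    unfolding lin_comb_def using assms by (intro finsum_cong') (auto simp: Pi_iff)
  also have "\<dots> = v i"
    using assms by (intro finsum_singleton) auto
  finally show ?thesis .
qed

text \<open>Composing two expansions, as in a matrix product, amounts to interchanging two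
  sums.\<close>

lemma lin_comb_finsum:
  assumes "v \<in> {..<t} \<rightarrow> carrier R" and "finite A"
    and "c \<in> A \<rightarrow> carrier R" "\<And>k. k \<in> A \<Longrightarrow> d k \<in> {..<t} \<rightarrow> carrier R"
  shows "lin_comb v t (\<lambda>l. \<Oplus>k\<in>A. c k \<otimes> d k l) = (\<Oplus>k\<in>A. c k \<otimes> lin_comb v t (d k))"
  using assms(2,3,4)
proof (induction A)
  case empty
  have "lin_comb v t (\<lambda>l. \<zero>) = lin_comb v t (\<lambda>l. \<zero> \<otimes> \<zero>)" by simp
  also have "\<dots> = \<zero>" using assms(1) by (subst lin_comb_smult) auto
  finally show ?case by simp
next
  case (insert x A)
  have cl: "l < t \<Longrightarrow> k \<in> insert x A \<Longrightarrow> c k \<otimes> d k l \<in> carrier R" for k l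
    using insert.prems by (auto simp: Pi_iff)
  have "lin_comb v t (\<lambda>l. \<Oplus>k\<in>insert x A. c k \<otimes> d k l) =
      lin_comb v t (\<lambda>l. c x \<otimes> d x l \<oplus> (\<Oplus>k\<in>A. c k \<otimes> d k l))"
    using insert.hyps assms(1) cl by (intro lin_comb_cong) (auto intro!: finsum_closed)
  also have "\<dots> = lin_comb v t (\<lambda>l. c x \<otimes> d x l) \<oplus> lin_comb v t (\<lambda>l. \<Oplus>k\<in>A. c k \<otimes> d k l)"
    using assms(1) cl by (intro lin_comb_add) (auto intro!: finsum_closed)
  also have "lin_comb v t (\<lambda>l. c x \<otimes> d x l) = c x \<otimes> lin_comb v t (d x)"
    using insert.prems assms(1) by (intro lin_comb_smult) auto
  also have "lin_comb v t (\<lambda>l. \<Oplus>k\<in>A. c k \<otimes> d k l) = (\<Oplus>k\<in>A. c k \<otimes> lin_comb v t (d k))"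
    using insert by auto
  also have "c x \<otimes> lin_comb v t (d x) \<oplus> (\<Oplus>k\<in>A. c k \<otimes> lin_comb v t (d k)) =
      (\<Oplus>k\<in>insert x A. c k \<otimes> lin_comb v t (d k))"
    using insert.prems insert.hyps assms(1)
    by (intro finsum_insert[symmetric]) (auto intro!: m_closed lin_comb_closed)
  finally show ?case .
qed

end

section \<open>Powers of a generator as a basis\<close>

text \<open>Multiplication by \<open>g\<close> permutes the nonzero vectors of the
  \<open>K\<close>-space \<open>E\<close> in a single cycle. Describing \<open>K\<close> by
  \<open>x ^ s = x\<close> makes membership a matter of exponents, and the given cardinalities let
  counting replace dimension theory.\<close>

locale singer_cycle = field +
  fixes K E :: "'a set" and g :: 'a and s n :: nat
  assumes K: "subfield K R" and E: "subfield E R" and K_le_E: "K \<subseteq> E"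
    and K_eq: "K = {x \<in> carrier R. x [^] s = x}"
    and fin_E: "finite E" and card_K: "card K = s" and card_E: "card E = s ^ n"
    and g: "g \<in> E" "g \<noteq> \<zero>" and gen: "E - {\<zero>} = {g [^] i | i::nat. True}"
    and g_order: "g [^] (s ^ n - 1) = \<one>"
begin

lemma K_carrier: "K \<subseteq> carrier R" and E_carrier: "E \<subseteq> carrier R"
  using K E by (auto dest: subfieldE(3))

lemma subring_K: "subring K R" and subring_E: "subring E R"
  using K E subfieldE(1) by auto

lemma fin_K: "finite K"
  using K_le_E fin_E finite_subset by blast

lemma s_ge_2: "s \<ge> 2"
proof -
  have "card {\<zero>, \<one>} \<le> card K"
    using subringE(2,3)[OF subring_K] fin_K by (intro card_mono) auto
  then show ?thesis using card_K by simp
qed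

lemma g_carrier [simp]: "g \<in> carrier R"
  using g E_carrier by auto

lemma g_pow_E: "g [^] (i::nat) \<in> E - {\<zero>}"
  using gen by blast

lemma g_pow_Pi [simp, intro]: "(\<lambda>i. g [^] (i::nat)) \<in> A \<rightarrow> carrier R"
  by auto

abbreviation comb :: "nat \<Rightarrow> (nat \<Rightarrow> 'a) \<Rightarrow> 'a"
  where "comb \<equiv> lin_comb (\<lambda>i. g [^] i)"

text \<open>The \<open>K\<close>-span of the first \<open>t\<close> powers of \<open>g\<close>.
  Extensional coefficient families keep the index set finite, which bounds the span by
  \<open>s ^ t\<close> elements.\<close>

abbreviation powspan :: "nat \<Rightarrow> 'a set"
  where "powspan t \<equiv> comb t ` ({..<t} \<rightarrow>\<^sub>E K)"

lemma Pi_K_carrier: "b \<in> A \<rightarrow> K \<Longrightarrow> b \<in> A \<rightarrow> carrier R"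
  using K_carrier by auto

lemma powspanI: "b \<in> {..<t} \<rightarrow> K \<Longrightarrow> comb t b \<in> powspan t"
  by (rule image_eqI[of _ _ "restrict b {..<t}"])
    (auto intro!: lin_comb_cong intro: subsetD[OF K_carrier])

lemma powspanE:
  assumes "x \<in> powspan t"
  obtains b where "b \<in> {..<t} \<rightarrow> K" "b \<in> {..<t} \<rightarrow> carrier R" "x = comb t b"
  using assms by (auto simp: PiE_iff Pi_iff intro: subsetD[OF K_carrier])

lemma powspan_add:
  assumes "x \<in> powspan t" "y \<in> powspan t" shows "x \<oplus> y \<in> powspan t"
proof -
  obtain b c where b: "b \<in> {..<t} \<rightarrow> K" "b \<in> {..<t} \<rightarrow> carrier R" "x = comb t b"
    and c: "c \<in> {..<t} \<rightarrow> K" "c \<in> {..<t} \<rightarrow> carrier R" "y = comb t c"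
    using assms by (metis powspanE)
  have "x \<oplus> y = comb t (\<lambda>i. b i \<oplus> c i)"
    using b c by (simp add: lin_comb_add)
  then show ?thesis
    using b(1) c(1) subringE(7)[OF subring_K] by (auto simp: Pi_iff intro!: powspanI)
qed

lemma powspan_smult:
  assumes "a \<in> K" "x \<in> powspan t" shows "a \<otimes> x \<in> powspan t"
proof -
  obtain b where b: "b \<in> {..<t} \<rightarrow> K" "b \<in> {..<t} \<rightarrow> carrier R" "x = comb t b"
    using assms by (metis powspanE)
  have "a \<otimes> x = comb t (\<lambda>i. a \<otimes> b i)"
    using b assms K_carrier by (subst lin_comb_smult) auto
  then show ?thesis
    using b(1) assms(1) subringE(6)[OF subring_K] by (auto simp: Pi_iff intro!: powspanI)
qed

lemma powspan_base:
  assumes "i < t" shows "g [^] i \<in> powspan t"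
  using powspanI[of "\<lambda>j. if i = j then \<one> else \<zero>" t] lin_comb_unit[of "\<lambda>i. g [^] i" t i]
    subringE(2,3)[OF subring_K] assms by auto

lemma powspan_zero: "\<zero> \<in> powspan t"
proof -
  have "\<zero> = comb t (\<lambda>i. \<zero> \<otimes> \<zero>)"
    by (subst lin_comb_smult) auto
  then show ?thesis
    using powspanI[of "\<lambda>i. \<zero> \<otimes> \<zero>" t] subringE(2)[OF subring_K] by auto
qed

lemma powspan_carrier: "powspan t \<subseteq> carrier R"
  by (auto elim!: powspanE simp del: image_iff)

lemma powspan_finsum:
  "f \<in> A \<rightarrow> powspan t \<Longrightarrow> finsum R f A \<in> powspan t"
proof (induction A rule: infinite_finite_induct)
  case (insert x A)
  then have "f x \<in> carrier R" "f \<in> A \<rightarrow> carrier R"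
    using powspan_carrier by blast+
  then show ?case
    using insert powspan_add by auto
qed (use powspan_zero in auto)

text \<open>If \<open>g^t\<close> is a combination of lower powers, then all powers of \<open>g\<close>, hence all of \<open>E\<close>, lie in a set
  with at most \<open>s^t\<close> elements.\<close>

lemma length_le_if_pow_in_powspan:
  assumes t: "g [^] t \<in> powspan t"
  shows "n \<le> t"
proof -
  obtain b where "g [^] t = comb t b"
    using t by (rule powspanE)
  \<comment> \<open>For \<open>t = 0\<close> the empty combination would give
    \<open>1 = 0\<close>.\<close>
  then have "t \<noteq> 0"
    by (intro notI) (simp add: lin_comb_def)
  \<comment> \<open>Multiplication by \<open>g\<close> shifts the powers by one. Only
    \<open>g ^ (t - 1)\<close> leaves the list, and its image \<open>g ^ t\<close> is in the span by
    assumption.\<close>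
  have step: "g \<otimes> x \<in> powspan t" if x: "x \<in> powspan t" for x
  proof -
    obtain b where b: "b \<in> {..<t} \<rightarrow> K" "x = comb t b"
      using x by (metis powspanE)
    have "g \<otimes> x = lin_comb (\<lambda>i. g \<otimes> g [^] i) t b"
      using b by (simp add: lin_comb_smult_vec Pi_K_carrier)
    moreover have "g \<otimes> g [^] i \<in> powspan t" if "i < t" for i
      using that t powspan_base[of "Suc i" t]
      by (cases "Suc i = t") (simp_all only: nat_pow_Suc2[OF g_carrier, symmetric] Suc_lessI)
    ultimately have "b i \<otimes> (g \<otimes> g [^] i) \<in> powspan t" if "i < t" for i
      using b(1) that by (auto intro!: powspan_smult[of "b i" "g \<otimes> g [^] i"] simp del: image_iff)
    then have "lin_comb (\<lambda>i. g \<otimes> g [^] i) t b \<in> powspan t"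
      by (subst lin_comb_def) (rule powspan_finsum, simp)
    then show ?thesis
      using \<open>g \<otimes> x = _\<close> by simp
  qed
  have "g [^] i \<in> powspan t" for i :: nat
  proof (induction i)
    case 0 then show ?case using powspan_base[of 0 t] \<open>t \<noteq> 0\<close> by simp
  next
    case (Suc i) then show ?case using step[of "g [^] i"] by (simp add: m_comm)
  qed
  then have "E - {\<zero>} \<subseteq> powspan t"
    unfolding gen by auto
  then have "E \<subseteq> powspan t"
    using powspan_zero by auto
  then have "s ^ n \<le> card (powspan t)"
    unfolding card_E[symmetric] using fin_K by (intro card_mono) (auto intro!: finite_PiE)
  also have "\<dots> \<le> card ({..<t} \<rightarrow>\<^sub>E K)"
    using fin_K by (intro card_image_le finite_PiE) auto
  also have "\<dots> = s ^ t"
    by (simp add: card_PiE card_K)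
  finally show ?thesis
    using s_ge_2 by (simp add: power_increasing_iff)
qed

text \<open>In a nontrivial relation the largest index \<open>t\<close> with nonzero coefficient
  expresses \<open>g ^ t\<close> by lower powers. That forces \<open>n \<le> t\<close>, against
  \<open>t < n\<close>.\<close>

lemma comb_eq_zeroD:
  assumes b: "b \<in> {..<n} \<rightarrow> K" and z: "comb n b = \<zero>" and "i < n"
  shows "b i = \<zero>"
proof (rule ccontr)
  assume "b i \<noteq> \<zero>"
  define S where "S = {i. i < n \<and> b i \<noteq> \<zero>}"
  define t where "t = Max S"
  have "t \<in> S"
    unfolding t_def using \<open>i < n\<close> \<open>b i \<noteq> \<zero>\<close> by (intro Max_in) (auto simp: S_def)
  then have t: "t < n" "b t \<noteq> \<zero>" by (auto simp: S_def)
  have above: "b j = \<zero>" if "t < j" "j < n" for j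
    using that Max_ge[of S j] by (fastforce simp: S_def t_def)
  have bc: "b j \<in> carrier R" "b j \<in> K" if "j < n" for j
    using b that K_carrier by auto
  have "\<zero> = (\<Oplus>j\<in>{..<n}. b j \<otimes> g [^] j)"
    using z by (simp add: lin_comb_def)
  also have "\<dots> = (\<Oplus>j\<in>{..<Suc t}. b j \<otimes> g [^] j)"
    by (rule add.finprod_mono_neutral_cong_right) (use t above bc in auto)
  also have "\<dots> = b t \<otimes> g [^] t \<oplus> comb t b"
    unfolding lin_comb_def lessThan_Suc using bc t by (subst finsum_insert) auto
  finally have eq: "b t \<otimes> g [^] t \<oplus> comb t b = \<zero>" by simp
  define a where "a = inv (b t)"
  have a: "a \<in> K" "a \<in> carrier R" "a \<otimes> b t = \<one>"
    using t bc subfield_m_inv[OF K, of "b t"] K_carrier unfolding a_def by auto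
  have cb: "comb t b \<in> carrier R"
    using bc t by (intro lin_comb_closed) auto
  have "g [^] t = a \<otimes> (b t \<otimes> g [^] t)"
    using a bc t by (simp flip: m_assoc)
  also have "b t \<otimes> g [^] t = \<ominus> comb t b"
    using eq bc t cb by (intro sum_zero_eq_neg) auto
  also have "a \<otimes> (\<ominus> comb t b) = (\<ominus> a) \<otimes> comb t b"
    using a cb by (simp add: l_minus r_minus)
  also have "\<dots> \<in> powspan t"
    using a b t subringE(5)[OF subring_K] by (intro powspan_smult powspanI) auto
  finally show False
    using length_le_if_pow_in_powspan t by fastforce
qed

text \<open>Linear independence gives injectivity; surjectivity follows by counting, since both
  sides have \<open>s ^ n\<close> elements.\<close>

lemma bij_comb: "bij_betw (comb n) ({..<n} \<rightarrow>\<^sub>E K) E"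
proof -
  have inj: "inj_on (comb n) ({..<n} \<rightarrow>\<^sub>E K)"
  proof (rule inj_onI)
    fix b b' assume b: "b \<in> {..<n} \<rightarrow>\<^sub>E K" "b' \<in> {..<n} \<rightarrow>\<^sub>E K" and eq: "comb n b = comb n b'"
    have c: "b \<in> {..<n} \<rightarrow> carrier R" "b' \<in> {..<n} \<rightarrow> carrier R"
      using b by (auto simp: PiE_iff Pi_K_carrier)
    have "comb n (\<lambda>i. b i \<ominus> b' i) = \<zero>"
      using c eq by (subst lin_comb_diff) (auto simp: r_right_minus_eq)
    moreover have "(\<lambda>i. b i \<ominus> b' i) \<in> {..<n} \<rightarrow> K"
      using b subringE(5,7)[OF subring_K] by (auto simp: a_minus_def PiE_iff)
    ultimately have "b i = b' i" if "i < n" for i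
      using comb_eq_zeroD[of "\<lambda>i. b i \<ominus> b' i" i] that c by (auto simp: r_right_minus_eq Pi_iff)
    then show "b = b'"
      using b by (intro PiE_ext) auto
  qed
  moreover have "comb n ` ({..<n} \<rightarrow>\<^sub>E K) = E"
  proof (rule card_subset_eq[OF fin_E])
    show "comb n ` ({..<n} \<rightarrow>\<^sub>E K) \<subseteq> E"
    proof (rule image_subsetI)
      fix b assume b: "b \<in> {..<n} \<rightarrow>\<^sub>E K"
      have "b i \<otimes> g [^] i \<in> E" if "i < n" for i
        using b that K_le_E g_pow_E[of i] by (intro subringE(6)[OF subring_E]) (auto simp: PiE_iff)
      then show "comb n b \<in> E"
        unfolding lin_comb_def by (intro finsum_in_subring[OF subring_E]) auto
    qed
    show "card (comb n ` ({..<n} \<rightarrow>\<^sub>E K)) = card E"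
      using card_image[OF inj] by (simp add: card_PiE card_K card_E)
  qed
  ultimately show ?thesis by (simp add: bij_betw_def)
qed

section \<open>Coordinates and windows of consecutive powers\<close>

definition coord :: "'a \<Rightarrow> nat \<Rightarrow> 'a"
  where "coord = inv_into ({..<n} \<rightarrow>\<^sub>E K) (comb n)"

lemma coord_Pi: "z \<in> E \<Longrightarrow> coord z \<in> {..<n} \<rightarrow>\<^sub>E K"
  unfolding coord_def using bij_betw_imp_surj_on[OF bij_comb] by (intro inv_into_into) simp

lemma comb_coord: "z \<in> E \<Longrightarrow> comb n (coord z) = z"
  unfolding coord_def using bij_betw_imp_surj_on[OF bij_comb] by (intro f_inv_into_f[of _ "comb n" "{..<n} \<rightarrow>\<^sub>E K"]) simp

lemma coord_unique:
  assumes b: "b \<in> {..<n} \<rightarrow> K" and "comb n b = z" "i < n"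
  shows "coord z i = b i"
proof -
  have r: "restrict b {..<n} \<in> {..<n} \<rightarrow>\<^sub>E K" using b by auto
  have "comb n (restrict b {..<n}) = z"
    using assms by (subst lin_comb_cong[of _ _ b]) (auto simp: Pi_K_carrier)
  then have "coord z = restrict b {..<n}"
    unfolding coord_def using inv_into_f_f[OF bij_betw_imp_inj_on[OF bij_comb] r] by simp
  then show ?thesis using \<open>i < n\<close> by simp
qed

lemma coord_K: "z \<in> E \<Longrightarrow> i < n \<Longrightarrow> coord z i \<in> K"
  using coord_Pi by (auto simp: PiE_iff)

text \<open>Since \<open>u\<close> and \<open>v\<close> are opposite exponents, the windows starting at \<open>g^u\<close> and \<open>g^v\<close> are the change of
  basis matrices from \<open>1, \<dots>, g^(n - 1)\<close> to a window and back.\<close>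

lemma coord_windows_inverse:
  fixes u v :: nat
  assumes uv: "g [^] (u + v) = \<one>" and "i < n" "l < n"
  shows "(\<Oplus>k\<in>{..<n}. coord (g [^] (u + i)) k \<otimes> coord (g [^] (v + k)) l) =
    (if i = l then \<one> else \<zero>)"
proof -
  define c where "c = coord (g [^] (u + i))"
  define d where "d = (\<lambda>k. coord (g [^] (v + k)))"
  have c: "k < n \<Longrightarrow> c k \<in> K" and d: "k' < n \<Longrightarrow> d k k' \<in> K" for k k'
    using coord_K g_pow_E unfolding c_def d_def by blast+
  have c': "c \<in> {..<n} \<rightarrow> carrier R" and d': "d k \<in> {..<n} \<rightarrow> carrier R" for k
    using c d K_carrier by auto
  \<comment> \<open>Row \<open>i\<close> of the product. It turns out to be the coordinate vector of
    \<open>g ^ i\<close>, which is a unit vector.\<close>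
  define b where "b = (\<lambda>l. \<Oplus>k\<in>{..<n}. c k \<otimes> d k l)"
  have b: "b \<in> {..<n} \<rightarrow> K"
    using c d subringE(6)[OF subring_K] unfolding b_def
    by (auto intro!: finsum_in_subring[OF subring_K])
  have "comb n b = (\<Oplus>k\<in>{..<n}. c k \<otimes> comb n (d k))"
    unfolding b_def using c' d' by (intro lin_comb_finsum) auto
  \<comment> \<open>Row \<open>d k\<close> represents \<open>g ^ (v + k)\<close>, so the product
    expands \<open>g ^ v\<close> times the element with coordinates \<open>c\<close>.\<close>
  also have "\<dots> = (\<Oplus>k\<in>{..<n}. c k \<otimes> (g [^] v \<otimes> g [^] k))"
    using comb_coord g_pow_E c' unfolding d_def
    by (intro finsum_cong') (auto simp: nat_pow_mult Pi_iff)
  also have "\<dots> = g [^] v \<otimes> comb n c"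
    using lin_comb_smult_vec[of "\<lambda>k. g [^] k" n c "g [^] v"] c' by (simp add: lin_comb_def)
  also have "comb n c = g [^] (u + i)"
    using comb_coord g_pow_E unfolding c_def by auto
  also have "g [^] v \<otimes> g [^] (u + i) = g [^] (u + v) \<otimes> g [^] i"
    by (simp add: nat_pow_mult ac_simps)
  finally have "comb n b = g [^] i"
    using uv by simp
  then have "coord (g [^] i) l = b l"
    using b \<open>l < n\<close> by (intro coord_unique)
  moreover have "coord (g [^] i) l = (if i = l then \<one> else \<zero>)"
    using coord_unique[of "\<lambda>l. if i = l then \<one> else \<zero>" "g [^] i" l] lin_comb_unit[of "\<lambda>i. g [^] i" n i]
      subringE(2,3)[OF subring_K] assms by auto
  ultimately show ?thesis by (simp add: b_def c_def d_def)
qed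

text \<open>A nonzero coefficient vector annihilating \<open>y\<close> represents some power of
  \<open>g\<close>. Reducing the exponent modulo \<open>N\<close> rescales this vector by an element
  of \<open>K\<close>, which preserves the relation.\<close>

lemma coord_cover:
  assumes F: "subfield F R" "K \<subseteq> F" and "finite F" "card F < s ^ n"
    and y: "y \<in> {..<n} \<rightarrow> F" and N: "N * (s - 1) = s ^ n - 1"
  obtains j where "j < N" "(\<Oplus>k\<in>{..<n}. coord (g [^] j) k \<otimes> y k) = \<zero>"
proof -
  have F_carrier: "F \<subseteq> carrier R" and subring_F: "subring F R"
    using F(1) by (auto dest: subfieldE)
  have yc: "y \<in> {..<n} \<rightarrow> carrier R" using y F_carrier by auto
  have "lin_comb y n ` ({..<n} \<rightarrow>\<^sub>E K) \<subseteq> F"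
  proof (rule image_subsetI)
    fix b assume b: "b \<in> {..<n} \<rightarrow>\<^sub>E K"
    have "b i \<otimes> y i \<in> F" if "i < n" for i
      using b that F(2) y by (intro subringE(6)[OF subring_F]) (auto simp: PiE_iff)
    then show "lin_comb y n b \<in> F"
      unfolding lin_comb_def by (intro finsum_in_subring[OF subring_F]) auto
  qed
  then have "card (lin_comb y n ` ({..<n} \<rightarrow>\<^sub>E K)) \<le> card F"
    using \<open>finite F\<close> by (intro card_mono)
  then have "card (lin_comb y n ` ({..<n} \<rightarrow>\<^sub>E K)) < card ({..<n} \<rightarrow>\<^sub>E K)"
    using \<open>card F < s ^ n\<close> by (simp add: card_PiE card_K)
  \<comment> \<open>There are fewer values than coefficient vectors; the difference of two colliding
    ones is a nontrivial \<open>K\<close>-relation between the entries of \<open>y\<close>.\<close>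
  then have "\<not> inj_on (lin_comb y n) ({..<n} \<rightarrow>\<^sub>E K)"
    by (rule pigeonhole)
  then obtain b b' where b: "b \<in> {..<n} \<rightarrow>\<^sub>E K" "b' \<in> {..<n} \<rightarrow>\<^sub>E K" "b \<noteq> b'"
    and eq: "lin_comb y n b = lin_comb y n b'"
    by (auto simp: inj_on_def)
  have bc: "b \<in> {..<n} \<rightarrow> carrier R" "b' \<in> {..<n} \<rightarrow> carrier R"
    using b by (auto simp: PiE_iff Pi_K_carrier)
  define d where "d = (\<lambda>i. b i \<ominus> b' i)"
  have d: "d \<in> {..<n} \<rightarrow> K"
    using b subringE(5,7)[OF subring_K] by (auto simp: d_def a_minus_def PiE_iff)
  then have dc: "d \<in> {..<n} \<rightarrow> carrier R" by (rule Pi_K_carrier)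
  obtain i where "i < n" "b i \<noteq> b' i"
    using b by (metis PiE_ext lessThan_iff)
  then have "d i \<noteq> \<zero>"
    using bc by (auto simp: d_def r_right_minus_eq Pi_iff)
  have dy: "lin_comb y n d = \<zero>"
    unfolding d_def using bc yc eq by (subst lin_comb_diff) (auto simp: r_right_minus_eq)
  have "comb n d \<noteq> \<zero>"
    using comb_eq_zeroD[OF d] \<open>i < n\<close> \<open>d i \<noteq> \<zero>\<close> by blast
  moreover have "comb n d \<in> E"
    using powspanI[OF d] bij_betw_imp_surj_on[OF bij_comb] by simp
  ultimately obtain t :: nat where t: "comb n d = g [^] t"
    using gen by blast
  have "s ^ n - 1 > 0"
    using subringE(2,3)[OF subring_E] fin_E card_E card_mono[of E "{\<zero>, \<one>}"] by auto
  then have "N > 0" using N by (cases N) auto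
  define j where "j = t mod N"
  \<comment> \<open>The order of \<open>g ^ N\<close> divides \<open>s - 1\<close>, so
    \<open>\<kappa> ^ s = \<kappa>\<close> and \<open>\<kappa>\<close> lies in
    \<open>K\<close>.\<close>
  define \<kappa> where "\<kappa> = g [^] (t div N * N)"
  have \<kappa>c: "\<kappa> \<in> carrier R" "\<kappa> \<noteq> \<zero>"
    using g_pow_E[of "t div N * N"] unfolding \<kappa>_def by auto
  have tj: "g [^] t = \<kappa> \<otimes> g [^] j"
    by (simp add: \<kappa>_def j_def nat_pow_mult)
  have gN: "g [^] (N * (s - 1)) = \<one>" using N g_order by simp
  have "\<kappa> [^] (s - 1) = (g [^] (N * (s - 1))) [^] (t div N)"
    by (simp add: \<kappa>_def nat_pow_pow ac_simps)
  then have "\<kappa> [^] (s - 1) = \<one>" by (simp only: gN nat_pow_one)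
  then have "\<kappa> [^] Suc (s - 1) = \<kappa>" using \<kappa>c by simp
  then have "\<kappa> [^] s = \<kappa>" using s_ge_2 by (simp del: nat_pow_Suc)
  then have "\<kappa> \<in> K" using K_eq \<kappa>c by auto
  then have inv: "inv \<kappa> \<in> K" "inv \<kappa> \<in> carrier R" "inv \<kappa> \<otimes> \<kappa> = \<one>"
    using subfield_m_inv[OF K, of \<kappa>] \<kappa>c K_carrier by auto
  have "comb n (\<lambda>i. inv \<kappa> \<otimes> d i) = inv \<kappa> \<otimes> (\<kappa> \<otimes> g [^] j)"
    using inv dc t tj by (subst lin_comb_smult) auto
  also have "\<dots> = g [^] j"
    using inv \<kappa>c by (simp flip: m_assoc)
  finally have co: "coord (g [^] j) i = inv \<kappa> \<otimes> d i" if "i < n" for i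
    using that inv d subringE(6)[OF subring_K] by (intro coord_unique) auto
  have "lin_comb y n (coord (g [^] j)) = lin_comb y n (\<lambda>i. inv \<kappa> \<otimes> d i)"
    using co inv dc yc by (intro lin_comb_cong) auto
  also have "\<dots> = \<zero>"
    using inv dc yc dy by (subst lin_comb_smult) auto
  finally have "lin_comb y n (coord (g [^] j)) = \<zero>" .
  then show thesis
    using that[of j] \<open>N > 0\<close> by (simp add: j_def lin_comb_def)
qed

end

section \<open>Matrix families without nowhere zero images\<close>

text \<open>The inner sum is formed in \<open>R\<close>; its partial sums stay in \<open>F\<close>,
  where \<open>h\<close> is additive. This avoids sums in the restricted ring.\<close>

lemma (in ring) hom_finsum_subring:
  assumes F: "subring F R" and S: "ring S" and h: "h \<in> ring_hom (R\<lparr>carrier := F\<rparr>) S"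
    and "\<phi> \<in> A \<rightarrow> F"
  shows "h (finsum R \<phi> A) = (\<Oplus>\<^bsub>S\<^esub>i\<in>A. h (\<phi> i))"
  using \<open>\<phi> \<in> A \<rightarrow> F\<close>
proof (induction A rule: infinite_finite_induct)
  case (insert x A)
  interpret S: ring S by fact
  have "\<phi> x \<in> F" "\<phi> \<in> A \<rightarrow> F" "finsum R \<phi> A \<in> F"
    using insert.prems finsum_in_subring[OF F, of \<phi> A] by auto
  moreover from this have "h (\<phi> x \<oplus> finsum R \<phi> A) = h (\<phi> x) \<oplus>\<^bsub>S\<^esub> h (finsum R \<phi> A)"
    using ring_hom_add[OF h] by simp
  moreover have "h (\<phi> i) \<in> carrier S" if "i \<in> insert x A" for i
    using insert.prems that ring_hom_closed[OF h] by auto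
  ultimately show ?case
    using insert subringE(1)[OF F] by (subst finsum_insert, auto)
qed (use ring_hom_zero[OF h subring_is_ring[OF F] S] in \<open>simp_all add: ring.is_abelian_group[OF S] abelian_group.axioms
  abelian_monoid.finsum_infinite abelian_monoid.finsum_empty\<close>)

lemma (in monoid) nat_pow_fixed_power:
  fixes s m :: nat
  assumes "x \<in> carrier G" "x [^] s = x"
  shows "x [^] (s ^ m) = x"
proof (induction m)
  case (Suc m)
  have "x [^] (s ^ Suc m) = (x [^] s) [^] (s ^ m)"
    using assms(1) by (simp add: nat_pow_pow)
  then show ?case using assms(2) Suc by simp
qed (use assms in simp)

text \<open>Powers in the restricted structure agree with those in \<open>R\<close>, so cyclicity of
  the unit group of a finite field carries over; its order \<open>card E - 1\<close> gives the last
  equation.\<close>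

lemma (in field) subfield_cyclic:
  assumes E: "subfield E R" and fin: "finite E"
  obtains g where "g \<in> E" "g \<noteq> \<zero>" "E - {\<zero>} = {g [^] i | i::nat. True}" "g [^] (card E - 1) = \<one>"
proof -
  let ?E = "R\<lparr>carrier := E\<rparr>"
  interpret E: field ?E using subfield_iff(2)[OF E] .
  have pow: "x [^]\<^bsub>?E\<^esub> (i::nat) = x [^] i" for x i
    by (simp add: nat_pow_def)
  obtain g where g: "g \<in> carrier (mult_of ?E)" "carrier (mult_of ?E) = {g [^]\<^bsub>?E\<^esub> i | i::nat. i \<in> UNIV}"
    using E.finite_field_mult_group_has_gen fin by fastforce
  have units: "Units ?E = E - {\<zero>}"
    using E.field_Units by simp
  then have "g \<in> Units ?E" "finite (Units ?E)"
    using g(1) fin by auto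
  then have "g [^]\<^bsub>?E\<^esub> card (Units ?E) = \<one>"
    using E.units_power_order_eq_one by fastforce
  moreover have "card (Units ?E) = card E - 1"
    using subringE(2)[OF subfieldE(1)[OF E]] fin by (simp add: units)
  ultimately show thesis
    using that[of g] g by (simp add: pow)
qed

text \<open>For \<open>k = 1\<close>, \<open>m\<close>, \<open>m + 1\<close> the fixed points of
  \<open>x \<mapsto> x ^ (s ^ k)\<close> are \<open>K\<close>, \<open>F\<close>, \<open>E\<close>.
  In general neither of \<open>F\<close> and \<open>E\<close> contains the other; what links them is
  \<open>K\<close>, which supplies the matrix entries.\<close>

lemma exists_singer_cycle:
  assumes "primepow s" "m \<ge> 1"
  obtains L :: "((int list \<times> nat) multiset \<Rightarrow> int) ring" and K E F g
  where "singer_cycle L K E g s (m + 1)" "subfield F L" "K \<subseteq> F" "card F = s ^ m"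
proof -
  obtain p e where p: "Factorial_Ring.prime p" "e > 0" and s: "s = p ^ e"
    using \<open>primepow s\<close> by (auto simp: primepow_def)
  obtain L :: "((int list \<times> nat) multiset \<Rightarrow> int) ring"
    where L: "field L" "[p] \<cdot>\<^bsub>L\<^esub> \<one>\<^bsub>L\<^esub> = \<zero>\<^bsub>L\<^esub>"
      and card: "\<And>k. k \<ge> 1 \<Longrightarrow> card {x \<in> carrier L. x [^]\<^bsub>L\<^esub> (p ^ k) = x} = p ^ k"
    using exists_field_frobenius_card[OF p(1)] by blast
  interpret L: field L by fact
  define Fix where "Fix = (\<lambda>k. {x \<in> carrier L. x [^]\<^bsub>L\<^esub> (s ^ k) = x})"
  have sub: "subfield (Fix k) L" for k
    using L.subfield_frobenius_fixed[OF p(1) L(2), of "e * k"] by (simp add: Fix_def s power_mult)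
  have card: "card (Fix k) = s ^ k" if "k \<ge> 1" for k
    using card[of "e * k"] p(2) that by (simp add: Fix_def s power_mult)
  have s0: "s > 0" using s p prime_gt_0_nat by simp
  have fin: "finite (Fix k)" if "k \<ge> 1" for k
    using card[OF that] s0 by (intro card_ge_0_finite) simp
  have mono: "Fix 1 \<subseteq> Fix k" for k
    using L.nat_pow_fixed_power by (auto simp: Fix_def)
  have "finite (Fix (m + 1))" by (rule fin) simp
  from L.subfield_cyclic[OF sub this]
  obtain g where g: "g \<in> Fix (m + 1)" "g \<noteq> \<zero>\<^bsub>L\<^esub>"
      "Fix (m + 1) - {\<zero>\<^bsub>L\<^esub>} = {g [^]\<^bsub>L\<^esub> i | i::nat. True}"
      "g [^]\<^bsub>L\<^esub> (card (Fix (m + 1)) - 1) = \<one>\<^bsub>L\<^esub>"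
    .
  have "singer_cycle L (Fix 1) (Fix (m + 1)) g s (m + 1)"
  proof (intro singer_cycle.intro singer_cycle_axioms.intro)
    show "Fix 1 = {x \<in> carrier L. x [^]\<^bsub>L\<^esub> s = x}" by (simp add: Fix_def)
    show "g [^]\<^bsub>L\<^esub> (s ^ (m + 1) - 1) = \<one>\<^bsub>L\<^esub>" using g(4) card[of "m + 1"] by simp
    show "card (Fix 1) = s" using card[of 1] by simp
    show "card (Fix (m + 1)) = s ^ (m + 1)" by (rule card) simp
    show "finite (Fix (m + 1))" by (rule fin) simp
  qed (fact L sub mono g)+
  then show thesis
    using that[of L "Fix 1" "Fix (m + 1)" g "Fix m"] sub mono card assms(2) by blast
qed

section \<open>The matrices formed from windows\<close>

context singer_cycle
begin

text \<open>The windows have entries in \<open>K\<close>, hence in \<open>F\<close>, and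
  \<open>f\<close> carries them to \<open>H\<close>, which will be a field of natural numbers as
  \<open>admissible\<close> demands. Windows starting at \<open>0, n, \<dots>, (r - 1) * n\<close>
  run through all exponents below \<open>r * n\<close>, hence below \<open>N\<close>.\<close>

lemma singer_family:
  assumes F: "subfield F R" "K \<subseteq> F" "finite F" "card F < s ^ n"
    and H: "field H" and f: "f \<in> ring_iso (R\<lparr>carrier := F\<rparr>) H"
    and n: "n > 0" and N: "N * (s - 1) = s ^ n - 1" "N \<le> r * n"
  obtains A where "\<And>i. A i \<in> GL n H"
    and "\<And>x. x \<in> vecs H n \<Longrightarrow> \<exists>i\<in>{1..r}. \<not> nowhere_zero H n (mat_vec H n (A i) x)"
proof -
  interpret H: field H by fact
  have hom: "f \<in> ring_hom (R\<lparr>carrier := F\<rparr>) H" and bij: "bij_betw f F (carrier H)"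
    using f by (auto simp: ring_iso_def)
  have subring_F: "subring F R" using F(1) subfieldE(1) by blast
  have f_zero: "f \<zero> = \<zero>\<^bsub>H\<^esub>" and f_one: "f \<one> = \<one>\<^bsub>H\<^esub>"
    using ring_hom_zero[OF hom subring_is_ring[OF subring_F] H.ring_axioms] ring_hom_one[OF hom] by auto
  have f_closed: "a \<in> F \<Longrightarrow> f a \<in> carrier H" for a
    using ring_hom_closed[OF hom] by simp
  have f_dot: "(\<Oplus>\<^bsub>H\<^esub>k\<in>{..<n}. f (a k) \<otimes>\<^bsub>H\<^esub> f (b k)) = f (\<Oplus>k\<in>{..<n}. a k \<otimes> b k)"
    if "\<And>k. k < n \<Longrightarrow> a k \<in> F" "\<And>k. k < n \<Longrightarrow> b k \<in> F" for a b
  proof -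
    have "f (\<Oplus>k\<in>{..<n}. a k \<otimes> b k) = (\<Oplus>\<^bsub>H\<^esub>k\<in>{..<n}. f (a k \<otimes> b k))"
      using that subringE(6)[OF subring_F]
      by (intro hom_finsum_subring[OF subring_F H.ring_axioms hom]) auto
    also have "\<dots> = (\<Oplus>\<^bsub>H\<^esub>k\<in>{..<n}. f (a k) \<otimes>\<^bsub>H\<^esub> f (b k))"
      using that ring_hom_mult[OF hom] f_closed by (intro H.finsum_cong') auto
    finally show ?thesis by simp
  qed
  \<comment> \<open>\<open>c v i\<close> is row \<open>i\<close> of the window that starts at
    \<open>g ^ v\<close>.\<close>
  define c where "c = (\<lambda>v i k. coord (g [^] (v + i :: nat)) k)"
  have c: "k < n \<Longrightarrow> c v i k \<in> F" for v i k
    using coord_K g_pow_E F(2) unfolding c_def by blast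
  define M where "M = (\<lambda>v. \<lambda>i\<in>{..<n}. \<lambda>k\<in>{..<n}. f (c v i k))"
  have M: "M v \<in> carrier (mat_monoid H n)" for v
    using c f_closed by (auto simp: M_def mat_monoid_def vecs_def)
  have inv: "M u \<otimes>\<^bsub>mat_monoid H n\<^esub> M v = \<one>\<^bsub>mat_monoid H n\<^esub>" if uv: "g [^] (u + v) = \<one>" for u v
  proof -
    have "(\<Oplus>\<^bsub>H\<^esub>k\<in>{..<n}. M u i k \<otimes>\<^bsub>H\<^esub> M v k l) = (if i = l then \<one>\<^bsub>H\<^esub> else \<zero>\<^bsub>H\<^esub>)"
      if il: "i < n" "l < n" for i l
    proof -
      have "(\<Oplus>\<^bsub>H\<^esub>k\<in>{..<n}. M u i k \<otimes>\<^bsub>H\<^esub> M v k l) = (\<Oplus>\<^bsub>H\<^esub>k\<in>{..<n}. f (c u i k) \<otimes>\<^bsub>H\<^esub> f (c v k l))"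
        using il c f_closed by (intro H.finsum_cong') (auto simp: M_def)
      also have "\<dots> = f (\<Oplus>k\<in>{..<n}. c u i k \<otimes> c v k l)"
        using c il by (intro f_dot) auto
      also have "(\<Oplus>k\<in>{..<n}. c u i k \<otimes> c v k l) = (if i = l then \<one> else \<zero>)"
        unfolding c_def by (rule coord_windows_inverse[OF uv il])
      finally show ?thesis by (simp add: f_zero f_one)
    qed
    then show ?thesis
      by (auto simp: mat_monoid_def fun_eq_iff)
  qed
  have GL: "M v \<in> GL n H" for v
  proof -
    \<comment> \<open>Chosen so that \<open>u + v\<close> is a multiple of \<open>s ^ n - 1\<close>;
      the windows at \<open>u\<close> and \<open>v\<close> are then inverse to each other.\<close>
    define u where "u = (s ^ n - 2) * v"
    have "s ^ n - 1 > 0"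
      using s_ge_2 n one_less_power[of s n] by simp
    then have "u + v = (s ^ n - 1) * v"
      by (cases "s ^ n") (auto simp: u_def algebra_simps)
    then have "g [^] (u + v) = (g [^] (s ^ n - 1)) [^] v"
      by (simp only: nat_pow_pow g_carrier)
    then have "g [^] (u + v) = \<one>" "g [^] (v + u) = \<one>"
      by (simp_all only: g_order nat_pow_one add.commute[of v u])
    then show ?thesis
      using M inv[of u v] inv[of v u] by (auto simp: GL_def Units_def)
  qed
  \<comment> \<open>Indices start at \<open>1\<close>, hence the shift; truncated subtraction sends
    \<open>0\<close> to the first window, which is invertible as well.\<close>
  define A where "A = (\<lambda>i. M ((i - 1) * n))"
  show thesis
  proof (rule that[of A])
    show "A i \<in> GL n H" for i by (simp add: A_def GL)
    fix x assume x: "x \<in> vecs H n"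
    define y where "y = (\<lambda>k. inv_into F f (x k))"
    have y: "y k \<in> F" "f (y k) = x k" if "k < n" for k
    proof -
      have "x k \<in> f ` F"
        using x that bij by (auto simp: vecs_def bij_betw_def PiE_iff)
      then show "y k \<in> F" "f (y k) = x k"
        by (auto simp: y_def inv_into_into f_inv_into_f)
    qed
    have xc: "x k \<in> carrier H" if "k < n" for k
      using x that by (auto simp: vecs_def PiE_iff)
    obtain j where j: "j < N" "(\<Oplus>k\<in>{..<n}. coord (g [^] j) k \<otimes> y k) = \<zero>"
      using coord_cover[OF F, of y N] y(1) N(1) by auto
    \<comment> \<open>Division with remainder locates exponent \<open>j\<close> as row
      \<open>l\<close> of matrix \<open>i\<close>.\<close>
    define i where "i = j div n + 1"
    define l where "l = j mod n"
    have l: "l < n" using n by (simp add: l_def)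
    have "j < r * n" using j(1) N(2) by simp
    then have i: "i \<in> {1..r}"
      using n by (simp add: i_def less_mult_imp_div_less Suc_le_eq)
    have jl: "(i - 1) * n + l = j" by (simp add: i_def l_def)
    have "mat_vec H n (A i) x l = (\<Oplus>\<^bsub>H\<^esub>k\<in>{..<n}. A i l k \<otimes>\<^bsub>H\<^esub> x k)"
      using l by (simp add: mat_vec_def)
    also have "\<dots> = (\<Oplus>\<^bsub>H\<^esub>k\<in>{..<n}. f (c j 0 k) \<otimes>\<^bsub>H\<^esub> f (y k))"
      using l jl c y xc f_closed by (intro H.finsum_cong') (auto simp: A_def M_def c_def)
    also have "\<dots> = f (\<Oplus>k\<in>{..<n}. c j 0 k \<otimes> y k)"
      using c y by (intro f_dot) auto
    also have "\<dots> = \<zero>\<^bsub>H\<^esub>"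
      using j(2) by (simp add: c_def f_zero)
    finally show "\<exists>i\<in>{1..r}. \<not> nowhere_zero H n (mat_vec H n (A i) x)"
      using i l by (auto simp: nowhere_zero_def)
  qed
qed

end

section \<open>The lower bound by prime powers\<close>

lemma admissibleD:
  assumes "Q \<in> admissible r" "primepow q" "real q > Q"
    and "field (H :: nat ring)" "card (carrier H) = q" "n \<ge> 1" "\<forall>i\<in>{1..r}. A i \<in> GL n H"
  shows "\<exists>x\<in>vecs H n. \<forall>i\<in>{1..r}. nowhere_zero H n (mat_vec H n (A i) x)"
proof -
  have "\<forall>q. primepow q \<and> real q > Q \<longrightarrow>
     (\<forall>F :: nat ring. field F \<and> card (carrier F) = q \<longrightarrow>
       (\<forall>n\<ge>1. \<forall>A. (\<forall>i\<in>{1..r}. A i \<in> GL n F) \<longrightarrow>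
         (\<exists>x\<in>vecs F n. \<forall>i\<in>{1..r}. nowhere_zero F n (mat_vec F n (A i) x))))"
    using assms(1) unfolding admissible_def by (rule CollectD)
  then show ?thesis
    using assms(2-) by presburger
qed

lemma geometric_sum_nat:
  fixes s :: nat
  assumes "s \<ge> 1"
  shows "(\<Sum>i<n. s ^ i) * (s - 1) = s ^ n - 1"
proof -
  have "(\<Sum>i<n. s ^ i) * (s - 1) + 1 = s ^ n"
    using assms by (cases s; induction n) (auto simp: algebra_simps)
  then show ?thesis by simp
qed

text \<open>The field of order \<open>s ^ m\<close> itself violates the defining condition, so no
  \<open>Q\<close> below \<open>s ^ m\<close> is admissible.\<close>

lemma Qinf_ge_power:
  assumes s: "primepow s" and m: "m \<ge> 1" and le: "s ^ (m + 1) - 1 \<le> r * (m + 1) * (s - 1)"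
  shows "Qinf r \<ge> ereal (real (s ^ m))"
  unfolding Qinf_def
proof (rule INF_greatest)
  fix Q assume Q: "Q \<in> admissible r"
  have s2: "s > 1" using primepow_gt_Suc_0[OF s] by simp
  show "ereal (real (s ^ m)) \<le> ereal Q"
  proof (rule ccontr)
    assume "\<not> ereal (real (s ^ m)) \<le> ereal Q"
    then have lt: "real (s ^ m) > Q" by simp
    obtain L :: "((int list \<times> nat) multiset \<Rightarrow> int) ring" and K E F g
      where sc: "singer_cycle L K E g s (m + 1)" and F: "subfield F L" "K \<subseteq> F" "card F = s ^ m"
      by (rule exists_singer_cycle[OF s m])
    interpret singer_cycle L K E g s "m + 1" by (rule sc)
    have fin: "finite F" using F(3) s2 by (intro card_ge_0_finite) simp
    \<comment> \<open>Elements of \<open>F\<close> are relabelled by natural numbers, the carrier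
      type in \<open>admissible\<close>.\<close>
    obtain f :: "((int list \<times> nat) multiset \<Rightarrow> int) \<Rightarrow> nat" where f: "inj_on f F"
      using finite_imp_inj_to_nat_seg[OF fin] by blast
    let ?F = "L\<lparr>carrier := F\<rparr>"
    define H where "H = image_ring f ?F"
    interpret F: field ?F using subfield_iff(2)[OF F(1)] .
    have H: "field H"
      unfolding H_def using f by (intro F.inj_imp_image_ring_is_field) simp
    have iso: "f \<in> ring_iso ?F H"
      unfolding H_def using f by (intro inj_imp_image_ring_iso) simp
    have card_H: "card (carrier H) = s ^ m"
      unfolding H_def image_ring_carrier using f F(3) by (simp add: card_image)
    \<comment> \<open>The number of points of projective \<open>m\<close>-space over a field of
      order \<open>s\<close>, that is, of nonzero vectors up to scaling.\<close>
    define N where "N = (\<Sum>i<m + 1. s ^ i)"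
    have N: "N * (s - 1) = s ^ (m + 1) - 1"
      unfolding N_def using s2 by (intro geometric_sum_nat) simp
    then have "N * (s - 1) \<le> r * (m + 1) * (s - 1)" using le by simp
    then have N_le: "N \<le> r * (m + 1)" using s2 by simp
    have "card F < s ^ (m + 1)" using s2 F(3) by simp
    then obtain A where A: "\<And>i. A i \<in> GL (m + 1) H"
      and cover: "\<And>x. x \<in> vecs H (m + 1) \<Longrightarrow>
        \<exists>i\<in>{1..r}. \<not> nowhere_zero H (m + 1) (mat_vec H (m + 1) (A i) x)"
      using singer_family[OF F(1,2) fin _ H iso _ N N_le] by (metis zero_less_Suc add_Suc_right add_0_right One_nat_def)
    have "primepow (s ^ m)"
      using s m s2 by (simp add: primepow_power_iff_nat)
    then obtain x where "x \<in> vecs H (m + 1)"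
      "\<forall>i\<in>{1..r}. nowhere_zero H (m + 1) (mat_vec H (m + 1) (A i) x)"
      using admissibleD[OF Q _ lt H card_H] A by (metis le_add2)
    then show False using cover by blast
  qed
qed

section \<open>Numerical consequences\<close>

text \<open>Turns the ceiling into the hypothesis of \<open>Qinf_ge_power\<close> for
  \<open>s = 2\<close>, where the factor \<open>s - 1\<close> is \<open>1\<close>.\<close>

lemma dseq_le_iff: "dseq m \<le> r \<longleftrightarrow> 2 ^ (m + 1) - 1 \<le> r * (m + 1)"
proof -
  have "dseq m \<le> r \<longleftrightarrow> (2 ^ (m + 1) - 1) / (real m + 1) \<le> real r"
    unfolding dseq_def by (simp add: nat_le_iff ceiling_le_iff del: power_Suc)
  also have "\<dots> \<longleftrightarrow> real (2 ^ (m + 1) - 1) \<le> real (r * (m + 1))"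
    by (simp add: divide_le_eq of_nat_diff algebra_simps)
  finally show ?thesis by (simp only: of_nat_le_iff)
qed

lemma Qinf_ge_power_two:
  assumes "m \<ge> 1" "dseq m \<le> r"
  shows "Qinf r \<ge> ereal (2 ^ m)"
proof -
  have "primepow (2 :: nat)" by (simp add: primepow_prime)
  then show ?thesis
    using Qinf_ge_power[of 2 m r] assms dseq_le_iff by simp
qed

text \<open>For \<open>m = 1\<close> the condition reads
  \<open>(q + 1) * (q - 1) \<le> 2 * r * (q - 1)\<close>, and \<open>q \<le> 2 * r - 1\<close>
  suffices.\<close>

lemma Qinf_ge_max_primepow:
  assumes "r \<ge> 2"
  shows "Qinf r \<ge> ereal (real (max_primepow r))"
proof -
  let ?S = "{q. primepow q \<and> q \<le> 2 * r - 1}"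
  have "finite ?S" by (rule finite_subset[of _ "{..2 * r - 1}"]) auto
  moreover have "2 \<in> ?S" using assms by (simp add: primepow_prime)
  ultimately have "max_primepow r \<in> ?S"
    unfolding max_primepow_def by (intro Max_in) blast+
  then have q: "primepow (max_primepow r)" and le: "max_primepow r + 1 \<le> 2 * r"
    using assms by auto
  define q where "q = max_primepow r"
  have "q ^ 2 - 1 = (q + 1) * (q - 1)"
    by (cases q) (auto simp: power2_eq_square algebra_simps)
  also have "\<dots> \<le> r * 2 * (q - 1)"
    using le by (intro mult_right_mono) (auto simp: q_def)
  finally show ?thesis
    using Qinf_ge_power[OF q, of 1 r] by (simp add: q_def numeral_2_eq_2)
qed

section \<open>Asymptotic estimates\<close>

lemma dseq_less: "real (dseq m) < 2 ^ (m + 1) / (real m + 1) + 1"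
proof -
  have "real (dseq m) < (2 ^ (m + 1) - 1) / (real m + 1) + 1"
    unfolding dseq_def by (simp add: of_nat_nat ceiling_correct del: power_Suc) linarith
  also have "\<dots> \<le> 2 ^ (m + 1) / (real m + 1) + 1"
    by (simp add: divide_right_mono)
  finally show ?thesis .
qed

lemma power_two_ge: "m + 1 \<le> (2::nat) ^ m"
  by (induction m) auto

lemma dseq_bounds: "1 \<le> dseq m" "dseq m \<le> 2 ^ (m + 1)"
proof -
  have "(2::nat) ^ (m + 1) > 1" by (rule one_less_power) auto
  then have "\<not> dseq m \<le> 0" unfolding dseq_le_iff by linarith
  then show "1 \<le> dseq m" by simp
  show "dseq m \<le> 2 ^ (m + 1)" by (simp add: dseq_le_iff del: power_Suc)
qed

lemma log_two_le:
  assumes "0 < x" "x \<le> 2 ^ k" shows "log 2 x \<le> real k"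
proof -
  have "log 2 x \<le> log 2 (2 ^ k)" using assms by (intro log_mono) auto
  also have "\<dots> = real k" by simp
  finally show ?thesis .
qed

text \<open>With \<open>e = (m + 1) / 2 ^ (m + 1)\<close>, the relative error of rounding up,
  \<open>d_m\<close> is at most \<open>2 ^ (m + 1) * (1 + e) / (m + 1)\<close> and its logarithm at
  most \<open>m + 1\<close>. The claim reduces to \<open>(1 - 2 * e) * (1 + e) \<le> 1\<close>;
  \<open>e \<le> 1/2\<close> keeps the factor \<open>1/2 - e\<close> nonnegative.\<close>

lemma dseq_log_bound:
  "(1/2 - (real m + 1) / 2 ^ (m + 1)) * real (dseq m) * log 2 (real (dseq m)) \<le> 2 ^ m"
proof -
  define e where "e = (real m + 1) / 2 ^ (m + 1)"
  have "real (m + 1) \<le> real (2 ^ m)" using power_two_ge by (simp only: of_nat_le_iff)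
  then have e: "0 \<le> e" "e \<le> 1/2" by (auto simp: e_def divide_simps)
  have "real (dseq m) \<le> real (2 ^ (m + 1))"
    using dseq_bounds(2) by (simp only: of_nat_le_iff)
  then have log: "log 2 (real (dseq m)) \<le> real (m + 1)"
    using dseq_bounds(1)[of m] by (intro log_two_le) auto
  have log0: "0 \<le> log 2 (real (dseq m))"
    using dseq_bounds(1)[of m] by simp
  have "real (dseq m) * log 2 (real (dseq m)) \<le> (2 ^ (m + 1) / (real m + 1) + 1) * real (m + 1)"
    using dseq_less[of m] log log0 by (intro mult_mono) auto
  also have "\<dots> = 2 ^ (m + 1) * (1 + e)"
    by (simp add: e_def field_simps)
  finally have "(1/2 - e) * (real (dseq m) * log 2 (real (dseq m))) \<le> (1/2 - e) * (2 ^ (m + 1) * (1 + e))"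
    using e by (intro mult_left_mono) auto
  also have "\<dots> = 2 ^ m * ((1 - 2 * e) * (1 + e))"
    by (simp add: algebra_simps)
  also have "\<dots> \<le> 2 ^ m * 1"
    using e by (intro mult_left_mono) (auto simp: algebra_simps)
  finally show ?thesis by (simp add: e_def mult.assoc)
qed

text \<open>For the largest \<open>m\<close> with \<open>d_m \<le> r\<close>, the bound \<open>r < d_(m + 1)\<close> already gives
  \<open>r log r \<le> 2^(m + 2)\<close>, so that no error term is needed.\<close>

lemma Qinf_ge_quarter:
  assumes "r \<ge> 2"
  shows "Qinf r \<ge> ereal (1/4 * real r * log 2 (real r))"
proof -
  \<comment> \<open>Index \<open>2 * r\<close> is large enough, because
    \<open>(r + 1) ^ 2 \<le> 4 ^ r\<close>.\<close>
  have ex: "\<exists>m. \<not> dseq m \<le> r"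
  proof -
    have "r * (2 * r + 1) < 2 ^ (2 * r + 1) - 1"
    proof -
      have "(r + 1) * (r + 1) \<le> 2 ^ r * 2 ^ r"
        using power_two_ge[of r] by (intro mult_mono) auto
      then have "(r + 1) * (r + 1) * 2 \<le> 2 ^ (2 * r + 1)"
        by (simp add: mult_2 power_add)
      then show ?thesis by (simp add: algebra_simps)
    qed
    then show ?thesis using dseq_le_iff[of "2 * r" r] by (intro exI[of _ "2 * r"]) simp
  qed
  \<comment> \<open>The least failing index bounds \<open>r\<close> from above at \<open>k\<close>
    and from below at \<open>k - 1\<close>, without monotonicity of \<open>dseq\<close>.\<close>
  define k where "k = (LEAST m. \<not> dseq m \<le> r)"
  have k: "\<not> dseq k \<le> r" and below: "\<And>m. m < k \<Longrightarrow> dseq m \<le> r"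
    unfolding k_def using LeastI_ex[OF ex] not_less_Least by blast+
  \<comment> \<open>The first two values are \<open>1\<close> and \<open>2\<close>; this ensures
    \<open>m \<ge> 1\<close>, as \<open>Qinf_ge_power_two\<close> requires.\<close>
  have "dseq 0 \<le> r" "dseq 1 \<le> r" using assms by (simp_all add: dseq_le_iff)
  then have "k \<noteq> 0" "k \<noteq> 1" using k by metis+
  then obtain m where km: "k = Suc m" "m \<ge> 1" by (cases k) auto
  have Q: "Qinf r \<ge> ereal (2 ^ m)"
    using below[of m] km by (intro Qinf_ge_power_two) auto
  have "r * (m + 2) \<le> 2 ^ (m + 2)"
    using k by (simp add: km dseq_le_iff)
  then have r: "real r * real (m + 2) \<le> 2 ^ (m + 2)"
    by (metis of_nat_le_iff of_nat_mult of_nat_numeral of_nat_power)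
  have "real r * 1 \<le> real r * real (m + 2)" by (intro mult_left_mono) auto
  then have "real r \<le> 2 ^ (m + 2)"
    using r by linarith
  then have "log 2 (real r) \<le> real (m + 2)"
    using assms by (intro log_two_le) auto
  then have "real r * log 2 (real r) \<le> real r * real (m + 2)"
    by (intro mult_left_mono) auto
  \<comment> \<open>The constant \<open>1/4\<close> is \<open>2 ^ m / 2 ^ (m + 2)\<close>.\<close>
  then have "1/4 * real r * log 2 (real r) \<le> 2 ^ m"
    using r by simp
  then have "ereal (1/4 * real r * log 2 (real r)) \<le> ereal (2 ^ m)" by simp
  then show ?thesis using Q by (rule order_trans)
qed

theorem proposition7p3:
  "(\<forall>r\<ge>2. Qinf r \<ge> ereal (real (max_primepow r))) \<and>
   (\<forall>m\<ge>1. \<forall>r\<ge>2. r \<ge> dseq m \<longrightarrow> Qinf r \<ge> ereal (2 ^ m)) \<and>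
   (\<exists>e \<in> o(\<lambda>_. 1). \<forall>\<^sub>F m in sequentially.
      Qinf (dseq m) \<ge> ereal ((1/2 - e m) * real (dseq m) * log 2 (real (dseq m)))) \<and>
   (\<exists>e \<in> o(\<lambda>_. 1). \<forall>\<^sub>F r in sequentially.
      Qinf r \<ge> ereal ((1/4 - e r) * real r * log 2 (real r)))"
proof (intro conjI)
  show "\<forall>r\<ge>2. Qinf r \<ge> ereal (real (max_primepow r))"
    using Qinf_ge_max_primepow by blast
  show "\<forall>m\<ge>1. \<forall>r\<ge>2. r \<ge> dseq m \<longrightarrow> Qinf r \<ge> ereal (2 ^ m)"
    using Qinf_ge_power_two by blast
  show "\<exists>e \<in> o(\<lambda>_. 1). \<forall>\<^sub>F m in sequentially.
      Qinf (dseq m) \<ge> ereal ((1/2 - e m) * real (dseq m) * log 2 (real (dseq m)))"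
  proof (rule bexI)
    \<comment> \<open>The error term is the one from \<open>dseq_log_bound\<close>.\<close>
    show "(\<lambda>m::nat. (real m + 1) / 2 ^ (m + 1)) \<in> o(\<lambda>_. 1)"
      by real_asymp
    show "\<forall>\<^sub>F m in sequentially. Qinf (dseq m) \<ge>
        ereal ((1/2 - (real m + 1) / 2 ^ (m + 1)) * real (dseq m) * log 2 (real (dseq m)))"
      using eventually_ge_at_top[of 1]
    proof eventually_elim
      case (elim m)
      have "ereal ((1/2 - (real m + 1) / 2 ^ (m + 1)) * real (dseq m) * log 2 (real (dseq m))) \<le> ereal (2 ^ m)"
        using dseq_log_bound by simp
      also have "\<dots> \<le> Qinf (dseq m)"
        using elim by (intro Qinf_ge_power_two) auto
      finally show ?case .
    qed
  qed
  show "\<exists>e \<in> o(\<lambda>_. 1). \<forall>\<^sub>F r in sequentially.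
      Qinf r \<ge> ereal ((1/4 - e r) * real r * log 2 (real r))"
    using Qinf_ge_quarter
    by (intro bexI[of _ "\<lambda>_. 0"] eventually_mono[OF eventually_ge_at_top[of 2]]) simp_all
qed

end
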